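(* Let $G$ be a connected triangle-free graph with $n$ vertices and $m$ edges, and suppose that $G$ is not isomorphic to the cycle $C_5$. Then $$\chi(G) \leq \left\lceil \frac{m}{\sqrt{5.5\,n}} \right\rceil + 1.$$
   Context: All graphs are finite and simple (no loops, no multiple edges), with at least one vertex. $\chi(G)$ denotes the (vertex) chromatic number of $G$. A graph is triangle-free if it contains no $K_3$ as a subgraph. $C_\ell$ denotes the cycle of length $\ell$. *)

theory Defs
  imports Complex_Main
begin

locale fin_simple_graph =
  fixes V :: "'a set" and E :: "'a set set"
  assumes finite_verts: "finite V"
    and verts_nonempty: "V \<noteq> {}"
    and edges_wf: "\<And>e. e \<in> E \<Longrightarrow> e \<subseteq> V \<and> card e = 2"

definition adj_rel :: "'a set set \<Rightarrow> ('a \<times> 'a) set" where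
  "adj_rel E = {(u, v). {u, v} \<in> E}"

definition graph_connected :: "'a set \<Rightarrow> 'a set set \<Rightarrow> bool" where
  "graph_connected V E \<longleftrightarrow> (\<forall>u\<in>V. \<forall>v\<in>V. (u, v) \<in> (adj_rel E)\<^sup>*)"

definition triangle_free :: "'a set \<Rightarrow> 'a set set \<Rightarrow> bool" where
  "triangle_free V E \<longleftrightarrow>
    \<not> (\<exists>x\<in>V. \<exists>y\<in>V. \<exists>z\<in>V. x \<noteq> y \<and> y \<noteq> z \<and> x \<noteq> z \<and> {x, y} \<in> E \<and> {y, z} \<in> E \<and> {x, z} \<in> E)"

definition graph_isomorphic ::
    "'a set \<Rightarrow> 'a set set \<Rightarrow> 'b set \<Rightarrow> 'b set set \<Rightarrow> bool" where
  "graph_isomorphic V E W F \<longleftrightarrow>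
    (\<exists>f. bij_betw f V W \<and> (\<forall>u\<in>V. \<forall>v\<in>V. {u, v} \<in> E \<longleftrightarrow> {f u, f v} \<in> F))"

text \<open>The cycle on \<open>l\<close> vertices, a simple graph only for \<open>l \<ge> 3\<close>.\<close>

definition cycle_verts :: "nat \<Rightarrow> nat set" where
  "cycle_verts l = {..<l}"

definition cycle_edges :: "nat \<Rightarrow> nat set set" where
  "cycle_edges l = {{i, Suc i mod l} | i. i < l}"

definition proper_colouring :: "'a set \<Rightarrow> 'a set set \<Rightarrow> nat \<Rightarrow> ('a \<Rightarrow> nat) \<Rightarrow> bool" where
  "proper_colouring V E k c \<longleftrightarrow>
    c ` V \<subseteq> {..<k} \<and> (\<forall>u\<in>V. \<forall>v\<in>V. {u, v} \<in> E \<longrightarrow> c u \<noteq> c v)"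

definition chromatic_number :: "'a set \<Rightarrow> 'a set set \<Rightarrow> nat" where
  "chromatic_number V E = (LEAST k. \<exists>c. proper_colouring V E k c)"

end

theory Submission
  imports Defs
begin

text \<open>
  If \<open>G\<close> has no proper colouring with \<open>k\<close> colours, then a smallest vertex set \<open>S\<close> inducing a
  subgraph with the same property induces a graph of minimum degree at least \<open>k\<close>
  (\<open>obtain_critical_subset\<close>).  Both sides of the argument are estimates for such an \<open>S\<close>.

  \<^item> \<open>S\<close> is large.  In a triangle-free graph the neighbourhood of a vertex \<open>v\<close> is independent, so it
    can be given one colour of its own; what is left after deleting \<open>v\<close> and its neighbours, at least
    \<open>k + 1\<close> vertices, still needs \<open>k\<close> colours.  Summing these losses, a triangle-free graph that is
    not \<open>k\<close>-colourable has at least \<open>2 + 3 + \<dots> + (k + 1) = k (k + 3) / 2\<close> vertices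
    (\<open>card_ge_of_not_colourable\<close>).
  \<^item> \<open>G\<close> has many edges.  The set \<open>S\<close> spans at least \<open>k |S| / 2\<close> edges, and as \<open>G\<close> is connected,
    every vertex outside \<open>S\<close> contributes at least one more.  Hence
    \<open>2 m \<ge> 2 n + (k - 2) |S|\<close> (\<open>twice_edges_ge\<close>).

  The theorem is trivial for \<open>\<chi>(G) \<le> 1\<close> and otherwise amounts to \<open>2 m\<^sup>2 > 11 (k - 1)\<^sup>2 n\<close> for
  \<open>k = \<chi>(G) - 1\<close>, which for \<open>k = 1\<close> only says that there is an edge.  For \<open>k \<ge> 4\<close> the second estimate
  and the inequality \<open>(x + y)\<^sup>2 \<ge> 4 x y\<close> give \<open>2 m\<^sup>2 \<ge> 4 (k - 2) |S| n\<close>, and the cubic lower bound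
  for \<open>4 (k - 2) |S|\<close> exceeds \<open>11 (k - 1)\<^sup>2\<close>.  For \<open>k = 3\<close> one needs \<open>|S| \<ge> 10\<close> in place of
  \<open>|S| \<ge> 9\<close>: a set of size \<open>9\<close> would have to be \<open>3\<close>-regular, against the parity of the degree sum.
  For \<open>k = 2\<close> one has \<open>m \<ge> n \<ge> 5\<close>, which is enough unless \<open>n = 5\<close>; but a triangle-free graph on
  five vertices that is not bipartite is \<open>C\<^sub>5\<close> (\<open>five_vertices_iso_C5\<close>).
\<close>

section \<open>Vertex-critical sets\<close>

context fin_simple_graph
begin

definition nbrs :: "'a set \<Rightarrow> 'a \<Rightarrow> 'a set" where
  "nbrs S v = {u \<in> S. {v, u} \<in> E}"

definition induced_edges :: "'a set \<Rightarrow> 'a set set" where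
  "induced_edges S = {e \<in> E. e \<subseteq> S}"

definition colourable :: "'a set \<Rightarrow> nat \<Rightarrow> bool" where
  "colourable S k \<longleftrightarrow> (\<exists>c. proper_colouring S E k c)"

lemma no_loop: "{v} \<notin> E"
  using edges_wf[of "{v}"] by auto

lemma finite_edges: "finite E"
  by (rule finite_subset[of _ "Pow V"]) (use edges_wf finite_verts in auto)

lemma finite_nbrs: "finite S \<Longrightarrow> finite (nbrs S v)"
  by (simp add: nbrs_def)

lemma not_self_nbr: "v \<notin> nbrs S v"
  using no_loop by (simp add: nbrs_def)

lemma in_nbrs_commute: "u \<in> S \<Longrightarrow> v \<in> S \<Longrightarrow> u \<in> nbrs S v \<longleftrightarrow> v \<in> nbrs S u"
  by (simp add: nbrs_def insert_commute)

lemma colourable_empty: "colourable {} k"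
  by (simp add: colourable_def proper_colouring_def)

text \<open>Greedy colouring: a colour of the smaller graph is left over for a vertex of small degree.\<close>

lemma colourable_insert_low_degree:
  assumes "finite S" "v \<in> S" "card (nbrs S v) < k" "colourable (S - {v}) k"
  shows "colourable S k"
proof -
  obtain c where c: "proper_colouring (S - {v}) E k c"
    using assms by (auto simp: colourable_def)
  have "card (c ` nbrs S v) < card {..<k}"
    using assms card_image_le[OF finite_nbrs[OF assms(1)], of c v] by simp
  then have "\<not> {..<k} \<subseteq> c ` nbrs S v"
    using card_mono[of "c ` nbrs S v" "{..<k}"] finite_nbrs[OF assms(1)] by fastforce
  then obtain a where a: "a < k" "a \<notin> c ` nbrs S v" by auto
  have "proper_colouring S E k (c(v := a))"
    unfolding proper_colouring_def
  proof (intro conjI ballI impI)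
    show "(c(v := a)) ` S \<subseteq> {..<k}"
      using c a by (auto simp: proper_colouring_def)
    fix x y assume xy: "x \<in> S" "y \<in> S" "{x, y} \<in> E"
    then have "x \<noteq> y" using no_loop by auto
    then show "(c(v := a)) x \<noteq> (c(v := a)) y"
      using xy a c by (auto simp: proper_colouring_def nbrs_def insert_commute)
  qed
  then show ?thesis by (auto simp: colourable_def)
qed

lemma obtain_critical_subset:
  assumes "finite S" "\<not> colourable S k"
  obtains T where "T \<subseteq> S" "\<not> colourable T k" "\<And>v. v \<in> T \<Longrightarrow> k \<le> card (nbrs T v)"
proof -
  have "\<exists>T \<subseteq> S. \<not> colourable T k \<and> (\<forall>v \<in> T. k \<le> card (nbrs T v))"
    using assms
  proof (induction S rule: finite_psubset_induct)
    case (psubset S)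
    show ?case
    proof (cases "\<forall>v \<in> S. k \<le> card (nbrs S v)")
      case True
      then show ?thesis using psubset by blast
    next
      case False
      then obtain v where v: "v \<in> S" "card (nbrs S v) < k" by (auto simp: not_le)
      then have "\<not> colourable (S - {v}) k"
        using colourable_insert_low_degree psubset by blast
      moreover have "S - {v} \<subset> S" using v by blast
      ultimately show ?thesis using psubset.IH[of "S - {v}"] by blast
    qed
  qed
  then show thesis using that by blast
qed

section \<open>Triangle-free graphs of given chromatic number have many vertices\<close>

text \<open>The neighbourhood of \<open>v\<close> is independent, so a new colour \<open>k\<close> serves for all of it, and then
  \<open>v\<close> itself can reuse any old colour; this is where \<open>k > 0\<close> enters.\<close>

lemma not_colourable_delete_closed_nbhd:
  assumes "triangle_free V E" "S \<subseteq> V" "v \<in> S" "k > 0" "\<not> colourable S (Suc k)"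
  shows "\<not> colourable (S - insert v (nbrs S v)) k"
proof
  let ?R = "S - insert v (nbrs S v)"
  assume "colourable ?R k"
  then obtain c where c: "proper_colouring ?R E k c" by (auto simp: colourable_def)
  define d where "d x = (if x = v then 0 else if x \<in> nbrs S v then k else c x)" for x
  have cR: "c x < k" if "x \<in> ?R" for x
    using c that by (auto simp: proper_colouring_def)
  have indep: "{x, y} \<notin> E" if "x \<in> nbrs S v" "y \<in> nbrs S v" for x y
  proof
    assume e: "{x, y} \<in> E"
    then have "x \<noteq> y" "v \<noteq> x" "v \<noteq> y" using no_loop that not_self_nbr by auto
    then show False
      using assms(1-3) that e unfolding triangle_free_def nbrs_def by blast
  qed
  have "proper_colouring S E (Suc k) d"
    unfolding proper_colouring_def
  proof (intro conjI ballI impI)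
    show "d ` S \<subseteq> {..<Suc k}"
      using cR by (fastforce simp: d_def)
    fix x y assume xy: "x \<in> S" "y \<in> S" "{x, y} \<in> E"
    then have ne: "x \<noteq> y" using no_loop by auto
    have yx: "{y, x} \<in> E" using xy by (simp add: insert_commute)
    consider "x = v" | "y = v" | "x \<noteq> v" "y \<noteq> v" "x \<in> nbrs S v"
      | "x \<noteq> v" "y \<noteq> v" "y \<in> nbrs S v" | "x \<in> ?R" "y \<in> ?R"
      using xy by auto
    then show "d x \<noteq> d y"
    proof cases
      case 1
      then have "y \<in> nbrs S v" using xy by (simp add: nbrs_def)
      then show ?thesis using 1 ne \<open>k > 0\<close> by (simp add: d_def)
    next
      case 2
      then have "x \<in> nbrs S v" using xy yx by (simp add: nbrs_def)
      then show ?thesis using 2 ne \<open>k > 0\<close> by (simp add: d_def)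
    next
      case 3
      then have "y \<in> ?R" using indep xy by auto
      then show ?thesis using 3 cR[of y] by (simp add: d_def)
    next
      case 4
      then have "x \<in> ?R" using indep xy by auto
      then show ?thesis using 4 cR[of x] by (simp add: d_def)
    next
      case 5
      then show ?thesis using c xy by (simp add: d_def proper_colouring_def)
    qed
  qed
  then show False using assms(5) by (auto simp: colourable_def)
qed

lemma card_delete_closed_nbhd:
  assumes "finite S" "v \<in> S"
  shows "card S = Suc (card (nbrs S v)) + card (S - insert v (nbrs S v))"
proof -
  have sub: "insert v (nbrs S v) \<subseteq> S" using assms by (auto simp: nbrs_def)
  have "card (insert v (nbrs S v)) = Suc (card (nbrs S v))"
    using assms finite_nbrs not_self_nbr by simp
  then show ?thesis
    using sub card_Diff_subset[of "insert v (nbrs S v)" S] card_mono[OF assms(1) sub]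
      finite_subset[OF sub assms(1)] by simp
qed

lemma card_ge_of_not_colourable:
  assumes "triangle_free V E" "S \<subseteq> V" "\<not> colourable S (Suc k)"
  shows "(k + 1) * (k + 4) \<le> 2 * card S"
  using assms(2,3)
proof (induction k arbitrary: S)
  case (0 S)
  have fin: "finite S" using 0 finite_verts finite_subset by blast
  obtain T where T: "T \<subseteq> S" "\<not> colourable T (Suc 0)" "\<And>v. v \<in> T \<Longrightarrow> Suc 0 \<le> card (nbrs T v)"
    using obtain_critical_subset[OF fin 0(2)] by blast
  obtain v where v: "v \<in> T" using T(2) colourable_empty by (cases "T = {}") auto
  have "card T \<ge> 2"
    using card_delete_closed_nbhd[of T v] T(3)[OF v] v finite_subset[OF T(1) fin] by simp
  then show ?case using card_mono[OF fin T(1)] by simp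
next
  case (Suc k S)
  have fin: "finite S" using Suc.prems finite_verts finite_subset by blast
  obtain T where T: "T \<subseteq> S" "\<not> colourable T (Suc (Suc k))"
      "\<And>v. v \<in> T \<Longrightarrow> Suc (Suc k) \<le> card (nbrs T v)"
    using obtain_critical_subset[OF fin Suc.prems(2)] by blast
  obtain v where v: "v \<in> T" using T(2) colourable_empty by (cases "T = {}") auto
  have TV: "T \<subseteq> V" using T Suc.prems by blast
  let ?R = "T - insert v (nbrs T v)"
  have "\<not> colourable ?R (Suc k)"
    using not_colourable_delete_closed_nbhd[OF assms(1) TV v _ T(2)] by simp
  then have "(k + 1) * (k + 4) \<le> 2 * card ?R"
    using Suc.IH[of ?R] TV by blast
  then have "(Suc k + 1) * (Suc k + 4) \<le> 2 * card T"
    using card_delete_closed_nbhd[of T v] T(3)[OF v] v finite_subset[OF T(1) fin]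
    by (simp add: algebra_simps)
  then show ?case using card_mono[OF fin T(1)] by linarith
qed

text \<open>A set just large enough for the bound above must be regular: deleting the neighbourhood of a
  vertex of larger degree would leave too few vertices.\<close>

lemma degree_add_card_bound:
  assumes "triangle_free V E" "S \<subseteq> V" "v \<in> S" "\<not> colourable S (Suc (Suc k))"
  shows "2 * card (nbrs S v) + 2 + (k + 1) * (k + 4) \<le> 2 * card S"
proof -
  let ?R = "S - insert v (nbrs S v)"
  have "\<not> colourable ?R (Suc k)"
    using not_colourable_delete_closed_nbhd[OF assms(1-3) _ assms(4)] by simp
  then have "(k + 1) * (k + 4) \<le> 2 * card ?R"
    using card_ge_of_not_colourable[OF assms(1), of ?R k] assms(2) by blast
  then show ?thesis
    using card_delete_closed_nbhd[of S v] assms(3) finite_subset[OF assms(2) finite_verts]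
    by linarith
qed

section \<open>Counting edges\<close>

lemma handshake:
  assumes "S \<subseteq> V"
  shows "(\<Sum>v\<in>S. card (nbrs S v)) = 2 * card (induced_edges S)"
proof -
  have finS: "finite S" using assms finite_verts finite_subset by blast
  have finE: "finite (induced_edges S)" using finite_edges by (simp add: induced_edges_def)
  have deg: "card (nbrs S v) = card {e \<in> induced_edges S. v \<in> e}" if "v \<in> S" for v
  proof (rule bij_betw_same_card[of "\<lambda>u. {v, u}"], rule bij_betw_imageI)
    show "inj_on (\<lambda>u. {v, u}) (nbrs S v)"
      by (auto simp: inj_on_def doubleton_eq_iff)
    show "(\<lambda>u. {v, u}) ` nbrs S v = {e \<in> induced_edges S. v \<in> e}"
    proof (intro equalityI subsetI)
      fix e assume e: "e \<in> {e \<in> induced_edges S. v \<in> e}"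
      then have "card e = 2" using edges_wf by (simp add: induced_edges_def)
      then obtain u where "e = {v, u}" using e by (auto simp: card_2_iff)
      then show "e \<in> (\<lambda>u. {v, u}) ` nbrs S v"
        using e by (auto simp: induced_edges_def nbrs_def)
    qed (use that in \<open>auto simp: induced_edges_def nbrs_def\<close>)
  qed
  have "(\<Sum>v\<in>S. card {e \<in> induced_edges S. v \<in> e}) = 2 * card (induced_edges S)"
  proof (rule sum_multicount[OF finS finE], rule ballI)
    fix e assume "e \<in> induced_edges S"
    then have "{v \<in> S. v \<in> e} = e" "card e = 2"
      using edges_wf by (auto simp: induced_edges_def)
    then show "card {v \<in> S. v \<in> e} = 2" by simp
  qed
  then show ?thesis using deg by simp
qed

lemma exists_leaving_edge:
  assumes "graph_connected V E" "S \<subseteq> V" "S \<noteq> {}" "S \<noteq> V"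
  obtains a b where "a \<in> S" "b \<in> V - S" "{a, b} \<in> E"
proof -
  obtain u v where uv: "u \<in> S" "v \<in> V - S" using assms by blast
  have "(u, v) \<in> (adj_rel E)\<^sup>*" using assms uv by (auto simp: graph_connected_def)
  then have "v \<in> S \<or> (\<exists>a \<in> S. \<exists>b. b \<notin> S \<and> {a, b} \<in> E)"
    by (induction rule: rtrancl_induct) (use uv in \<open>auto simp: adj_rel_def\<close>)
  then show thesis using that uv edges_wf by blast
qed

text \<open>Growing \<open>S\<close> to \<open>V\<close> one vertex at a time along edges that leave it, every new vertex brings
  at least one new edge.\<close>

lemma connected_edges_ge:
  assumes "graph_connected V E" "S \<subseteq> V" "S \<noteq> {}"
  shows "card (induced_edges S) + card (V - S) \<le> card E"
  using assms(2,3)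
proof (induction "card (V - S)" arbitrary: S)
  case 0
  then show ?case
    using finite_edges by (simp add: induced_edges_def card_mono)
next
  case (Suc d S)
  then have "S \<noteq> V" by auto
  then obtain a b where ab: "a \<in> S" "b \<in> V - S" "{a, b} \<in> E"
    using exists_leaving_edge[OF assms(1) Suc.prems] by blast
  have "V - insert b S = V - S - {b}" by blast
  moreover have "Suc (card (V - S - {b})) = card (V - S)"
    using ab finite_verts by (intro card_Suc_Diff1) auto
  ultimately have card: "card (V - S) = Suc (card (V - insert b S))" by metis
  have "card (induced_edges (insert b S)) + card (V - insert b S) \<le> card E"
  proof (rule Suc.hyps(1))
    show "d = card (V - insert b S)" using card Suc.hyps(2) by linarith
  qed (use Suc.prems ab in auto)
  moreover have "card (induced_edges S) < card (induced_edges (insert b S))"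
  proof (rule psubset_card_mono)
    show "finite (induced_edges (insert b S))"
      using finite_edges by (simp add: induced_edges_def)
    have "{a, b} \<in> induced_edges (insert b S) - induced_edges S"
      using ab by (simp add: induced_edges_def)
    moreover have "induced_edges S \<subseteq> induced_edges (insert b S)"
      by (auto simp: induced_edges_def)
    ultimately show "induced_edges S \<subset> induced_edges (insert b S)" by blast
  qed
  ultimately show ?case using card by linarith
qed

lemma twice_edges_ge:
  assumes "graph_connected V E" "S \<subseteq> V" "S \<noteq> {}" "\<And>v. v \<in> S \<Longrightarrow> k \<le> card (nbrs S v)"
  shows "2 * card V + k * card S \<le> 2 * card E + 2 * card S"
proof -
  have "k * card S \<le> (\<Sum>v\<in>S. card (nbrs S v))"
    using sum_bounded_below[of S k "\<lambda>v. card (nbrs S v)"] assms(4) by (simp add: mult.commute)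
  then have "k * card S \<le> 2 * card (induced_edges S)"
    using handshake[OF assms(2)] by simp
  moreover have "card V = card S + card (V - S)"
    using assms(2) finite_verts card_Diff_subset[of S V] card_mono[of V S] finite_subset by fastforce
  ultimately show ?thesis
    using connected_edges_ge[OF assms(1-3)] by linarith
qed

section \<open>The exceptional cases of few colours\<close>

text \<open>A triangle-free graph on five vertices that is not bipartite is \<open>2\<close>-regular, because three
  neighbours leave room for only one further vertex.  From \<open>v\<^sub>0\<close> with neighbours \<open>v\<^sub>1, v\<^sub>4\<close>, the
  cycle is then traced along the unique continuation \<open>v\<^sub>2\<close> at \<open>v\<^sub>1\<close>; the fifth vertex \<open>v\<^sub>3\<close> can
  be joined only to \<open>v\<^sub>2\<close> and \<open>v\<^sub>4\<close>.\<close>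

lemma five_vertices_iso_C5:
  assumes tf: "triangle_free V E" and "\<not> colourable V 2" "card V = 5"
  shows "graph_isomorphic V E (cycle_verts 5) (cycle_edges 5)"
proof -
  have fin: "finite V" by (rule finite_verts)
  have two: "Suc (Suc 0) = 2" by simp
  have le: "card (nbrs V v) \<le> 2" if "v \<in> V" for v
    using degree_add_card_bound[OF tf subset_refl that, of 0, unfolded two, OF assms(2)] assms(3)
    by simp
  obtain T where T: "T \<subseteq> V" "\<not> colourable T 2" "\<And>v. v \<in> T \<Longrightarrow> 2 \<le> card (nbrs T v)"
    using obtain_critical_subset[OF fin assms(2)] by blast
  have "5 \<le> card T"
    using card_ge_of_not_colourable[OF tf T(1), of 1, unfolded One_nat_def two, OF T(2)] by simp
  then have "T = V" using T(1) assms(3) fin by (intro card_seteq) auto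
  then have deg: "card (nbrs V v) = 2" if "v \<in> V" for v
    using le T(3) that by (simp add: le_antisym)
  have other: "\<exists>z. z \<noteq> y \<and> nbrs V x = {y, z}" if "x \<in> V" "y \<in> nbrs V x" for x y
    using deg[OF that(1)] that(2) by (auto simp: card_2_iff)
  have sub: "nbrs V x \<subseteq> V" for x by (auto simp: nbrs_def)
  have sym: "y \<in> nbrs V x \<Longrightarrow> x \<in> V \<Longrightarrow> x \<in> nbrs V y" for x y
    using in_nbrs_commute[of y V x] sub by blast
  have no_tri: "z \<notin> nbrs V x" if "y \<in> nbrs V x" "z \<in> nbrs V y" "x \<in> V" for x y z
  proof
    assume z: "z \<in> nbrs V x"
    have "x \<noteq> y" "y \<noteq> z" "x \<noteq> z" using that z not_self_nbr by auto
    then show False using tf that z unfolding triangle_free_def nbrs_def by blast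
  qed
  obtain v0 where v0: "v0 \<in> V" using verts_nonempty by blast
  obtain v1 v4 where n0: "nbrs V v0 = {v1, v4}" "v1 \<noteq> v4"
    using deg[OF v0] by (auto simp: card_2_iff)
  have v14: "v1 \<in> V" "v4 \<in> V" using n0 sub[of v0] by auto
  obtain v2 where n1: "nbrs V v1 = {v0, v2}" "v2 \<noteq> v0"
    using other[of v1 v0] sym[of v1 v0] n0 v0 v14 by auto
  have v2: "v2 \<in> V" using n1 sub[of v1] by auto
  have ne: "v0 \<noteq> v1" "v0 \<noteq> v4" "v1 \<noteq> v2" "v2 \<noteq> v4"
    using not_self_nbr[of v0 V] not_self_nbr[of v1 V] n0 n1 no_tri[of v1 v0 v2] v0 by auto
  have "card {v0, v1, v2, v4} = 4" using ne n0 n1 by simp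
  then have "card (V - {v0, v1, v2, v4}) = 1"
    using assms(3) v0 v14 v2 by (simp add: card_Diff_subset)
  then obtain v3 where v3: "V - {v0, v1, v2, v4} = {v3}" by (auto simp: card_1_singleton_iff)
  then have V: "V = {v0, v1, v2, v3, v4}" and ne3: "v3 \<notin> {v0, v1, v2, v4}"
    using v0 v14 v2 by auto
  have "nbrs V v3 \<subseteq> {v2, v4}"
  proof
    fix x assume x: "x \<in> nbrs V v3"
    then have "x \<in> V" "v3 \<in> nbrs V x" using sub sym[of x v3] V by auto
    then show "x \<in> {v2, v4}" using V n0 n1 ne3 not_self_nbr[of v3 V] by auto
  qed
  then have n3: "nbrs V v3 = {v2, v4}"
    using deg[of v3] ne V card_subset_eq[of "{v2, v4}" "nbrs V v3"] by simp
  have n2: "nbrs V v2 = {v1, v3}"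
    using other[of v2 v1] sym[of v2 v1] sym[of v2 v3] n1 n3 V ne3 by auto
  have n4: "nbrs V v4 = {v0, v3}"
    using other[of v4 v0] sym[of v4 v0] sym[of v4 v3] n0 n3 V ne3 by auto
  define f where "f x = (if x = v0 then 0 else if x = v1 then 1 else if x = v2 then 2
      else if x = v3 then 3 else (4::nat))" for x
  have f: "f v0 = 0" "f v1 = 1" "f v2 = 2" "f v3 = 3" "f v4 = 4"
    using ne ne3 n0 n1 by (auto simp: f_def)
  have five: "{..<5::nat} = {0, 1, 2, 3, 4}" by auto
  have C5: "cycle_edges 5 = {{0, 1}, {1, 2}, {2, 3}, {3, 4}, {4, 0}}"
  proof -
    have "cycle_edges 5 = (\<lambda>i. {i, Suc i mod 5}) ` {..<5}" by (auto simp: cycle_edges_def)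
    then show ?thesis by (simp add: five del: One_nat_def)
  qed
  have "bij_betw f V (cycle_verts 5)"
    using ne ne3 n0 n1 unfolding bij_betw_def cycle_verts_def five V
    by (simp add: inj_on_def f)
  moreover have "\<forall>u\<in>V. \<forall>v\<in>V. {u, v} \<in> E \<longleftrightarrow> {f u, f v} \<in> cycle_edges 5"
  proof -
    have d: "v0 \<noteq> v1" "v0 \<noteq> v2" "v0 \<noteq> v3" "v0 \<noteq> v4" "v1 \<noteq> v2" "v1 \<noteq> v3" "v1 \<noteq> v4"
      "v2 \<noteq> v3" "v2 \<noteq> v4" "v3 \<noteq> v4"
      using ne ne3 n0 n1 by auto
    have "\<forall>u\<in>{v0, v1, v2, v3, v4}. \<forall>v\<in>{v0, v1, v2, v3, v4}.
        v \<in> nbrs V u \<longleftrightarrow> {f u, f v} \<in> cycle_edges 5"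
      by (simp add: n0 n1 n2 n3 n4 f C5 doubleton_eq_iff d d[THEN not_sym])
    then have "\<forall>u\<in>V. \<forall>v\<in>V. v \<in> nbrs V u \<longleftrightarrow> {f u, f v} \<in> cycle_edges 5"
      by (simp only: V[symmetric])
    then show ?thesis by (simp add: nbrs_def)
  qed
  ultimately show ?thesis by (auto simp: graph_isomorphic_def)
qed

text \<open>Equality \<open>|S| = 9\<close> in the general vertex bound forces a \<open>3\<close>-regular graph on an odd number of
  vertices.\<close>

lemma critical_three_card_ge:
  assumes tf: "triangle_free V E" and S: "S \<subseteq> V" "\<not> colourable S 3"
    and deg: "\<And>v. v \<in> S \<Longrightarrow> 3 \<le> card (nbrs S v)"
  shows "10 \<le> card S"
proof (rule ccontr)
  assume "\<not> 10 \<le> card S"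
  moreover have "9 \<le> card S"
    using card_ge_of_not_colourable[OF tf S(1), of 2] S(2) by (simp add: numeral_3_eq_3)
  ultimately have nine: "card S = 9" by simp
  have "card (nbrs S v) = 3" if "v \<in> S" for v
    using degree_add_card_bound[OF tf S(1) that, of 1] S(2) deg[OF that] nine
    by (simp add: numeral_3_eq_3)
  then have "(\<Sum>v\<in>S. card (nbrs S v)) = 27" using nine by simp
  then have "27 = 2 * card (induced_edges S)" using handshake[OF S(1)] by simp
  then show False by presburger
qed

section \<open>The edge bound\<close>

text \<open>This is \<open>m / \<surd>(5.5 n) > k\<close>, squared and cleared of denominators, for a graph with
  \<open>\<chi> \<ge> k + 2\<close>.\<close>

lemma edges_square_gt:
  assumes con: "graph_connected V E" and tf: "triangle_free V E"
    and nc: "\<not> colourable V (Suc k)"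
    and not_C5: "\<not> graph_isomorphic V E (cycle_verts 5) (cycle_edges 5)"
  shows "11 * k\<^sup>2 * card V < 2 * (card E)\<^sup>2"
proof -
  obtain S where S: "S \<subseteq> V" "\<not> colourable S (Suc k)" "\<And>v. v \<in> S \<Longrightarrow> Suc k \<le> card (nbrs S v)"
    using obtain_critical_subset[OF finite_verts nc] by blast
  have "S \<noteq> {}" using S(2) colourable_empty by auto
  then have edges: "2 * card V + Suc k * card S \<le> 2 * card E + 2 * card S"
    using twice_edges_ge[OF con S(1) _ S(3)] by simp
  have size: "(k + 1) * (k + 4) \<le> 2 * card S"
    by (rule card_ge_of_not_colourable[OF tf S(1,2)])
  have SV: "card S \<le> card V" using S(1) finite_verts card_mono by blast
  have "k = 0 \<or> k = 1 \<or> k = 2 \<or> k = (k - 3) + 3" by linarith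
  then consider "k = 0" | "k = 1" | "k = 2" | j where "k = j + 3" by blast
  then show ?thesis
  proof cases
    case 1
    then show ?thesis using edges size SV by simp
  next
    case 2
    then have mn: "card V \<le> card E" and n5: "5 \<le> card V" using edges size SV by auto
    have "card V \<noteq> 5"
      using five_vertices_iso_C5[OF tf] nc not_C5 2 by (auto simp: numeral_2_eq_2)
    then have "11 * card V < 2 * (card V * card V)" using n5 by simp
    also have "\<dots> \<le> 2 * (card E * card E)" using mn by (simp add: mult_mono)
    finally show ?thesis using 2 by (simp add: power2_eq_square)
  next
    case 3
    then have s10: "10 \<le> card S"
      using critical_three_card_ge[OF tf S(1)] S(2,3) by (simp add: numeral_3_eq_3)
    define n where "n = int (card V)"
    have n: "n \<ge> 10" using s10 SV by (simp add: n_def)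
    have "n + 5 \<le> int (card E)" using edges 3 s10 by (simp add: n_def)
    then have "(n + 5)\<^sup>2 \<le> (int (card E))\<^sup>2" using n by (intro power_mono) auto
    \<comment> \<open>\<open>(n + 5)\<^sup>2 - 22 n = (n - 6)\<^sup>2 - 11\<close> is positive for \<open>n \<ge> 10\<close>\<close>
    moreover have "4 * 4 \<le> (n - 6) * (n - 6)" using n by (intro mult_mono) auto
    ultimately have "44 * n < 2 * (int (card E))\<^sup>2"
      by (simp add: power2_eq_square algebra_simps)
    then have "int (44 * card V) < int (2 * (card E)\<^sup>2)" by (simp add: n_def)
    then show ?thesis using 3 by (simp only: of_nat_less_iff) simp
  next
    case (4 j)
    define n m s i where "n = int (card V)" and "m = int (card E)" and "s = int (card S)"
      and "i = int j"
    have i: "i \<ge> 0" and n: "n > 0"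
      using finite_verts verts_nonempty by (simp_all add: i_def n_def card_gt_0_iff)
    have "int (2 * card V + Suc k * card S) \<le> int (2 * card E + 2 * card S)"
      using edges by (simp only: of_nat_le_iff)
    then have edges': "2 * n + (i + 2) * s \<le> 2 * m"
      using 4 by (simp add: n_def m_def s_def i_def algebra_simps)
    have "int ((k + 1) * (k + 4)) \<le> int (2 * card S)" using size by (simp only: of_nat_le_iff)
    then have size': "(i + 4) * (i + 7) \<le> 2 * s"
      using 4 by (simp add: s_def i_def algebra_simps)
    have "11 * (i + 3)\<^sup>2 < 2 * (i + 2) * ((i + 4) * (i + 7))"
    proof -
      have "2 * (i + 2) * ((i + 4) * (i + 7)) - 11 * (i + 3)\<^sup>2 = 2 * (i * (i * i)) + 15 * (i * i) + 34 * i + 13"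
        by (simp add: power2_eq_square algebra_simps)
      then show ?thesis using i by (smt (verit) mult_nonneg_nonneg)
    qed
    also have "\<dots> \<le> 2 * (i + 2) * (2 * s)" using size' i by (intro mult_left_mono) auto
    finally have cubic: "11 * (i + 3)\<^sup>2 * n < 2 * (i + 2) * (2 * s) * n" using n by simp
    \<comment> \<open>\<open>(x + y)\<^sup>2 \<ge> 4 x y\<close> with \<open>x = 2 n\<close> and \<open>y = (i + 2) s\<close>\<close>
    have "0 \<le> (2 * n - (i + 2) * s)\<^sup>2" by simp
    then have "2 * (2 * (i + 2) * (2 * s) * n) \<le> (2 * n + (i + 2) * s)\<^sup>2"
      by (simp add: power2_eq_square algebra_simps)
    also have "\<dots> \<le> (2 * m)\<^sup>2"
      using edges' i n by (intro power_mono) (auto simp: s_def)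
    finally have "2 * (i + 2) * (2 * s) * n \<le> 2 * m\<^sup>2" by (simp add: power_mult_distrib)
    with cubic have "11 * (i + 3)\<^sup>2 * n < 2 * m\<^sup>2" by linarith
    then have "int (11 * k\<^sup>2 * card V) < int (2 * (card E)\<^sup>2)"
      using 4 by (simp add: n_def m_def i_def)
    then show ?thesis by (simp only: of_nat_less_iff)
  qed
qed

end

section \<open>The bound on the chromatic number\<close>

theorem theorem6:
  fixes V :: "'a set" and E :: "'a set set" and n m :: nat
  assumes "fin_simple_graph V E"
    and "graph_connected V E"
    and "triangle_free V E"
    and "card V = n"
    and "card E = m"
    and "\<not> graph_isomorphic V E (cycle_verts 5) (cycle_edges 5)"
  shows "int (chromatic_number V E) \<le> \<lceil>real m / sqrt (5.5 * real n)\<rceil> + 1"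
proof (rule ccontr)
  interpret fin_simple_graph V E by (rule assms(1))
  define x where "x = real m / sqrt (5.5 * real n)"
  have n: "n > 0" using finite_verts verts_nonempty assms(4) by (auto simp: card_gt_0_iff)
  have "0 \<le> x" by (simp add: x_def)
  then have x0: "0 \<le> \<lceil>x\<rceil>" by linarith
  assume "\<not> ?thesis"
  then have less: "\<lceil>x\<rceil> + 1 < int (chromatic_number V E)" by (simp add: x_def)
  define k where "k = chromatic_number V E - 2"
  have chi: "chromatic_number V E = k + 2" using less x0 unfolding k_def by linarith
  have "Suc k < chromatic_number V E" using chi by simp
  then have "\<not> colourable V (Suc k)"
    unfolding chromatic_number_def colourable_def by (rule not_less_Least)
  then have "11 * k\<^sup>2 * n < 2 * m\<^sup>2"
    using edges_square_gt assms by blast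
  then have "real (11 * k\<^sup>2 * n) < real (2 * m\<^sup>2)" by (simp only: of_nat_less_iff)
  then have "(real k * sqrt (5.5 * real n))\<^sup>2 < (real m)\<^sup>2" by (simp add: power_mult_distrib)
  then have "real k * sqrt (5.5 * real n) < real m" by (rule power2_less_imp_less) simp
  then have "real k < x" using n by (simp add: x_def pos_less_divide_eq)
  moreover have "x \<le> real k" using less chi by linarith
  ultimately show False by simp
qed

end
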